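(* Let $L,N\ge 1$ be integers, $\alpha>0$, and let $H=(H_0,\dots,H_{L-1})$ be the discrete-time Rayleigh fading channel with covariance matrix $\Gamma=(\gamma_{ik})_{0\le i,k\le L-1}$ (defined in the context). Let $\hat H_n=\sum_{l=0}^{L-1}H_l e^{-j2\pi nl/N}$ for $n\in\{0,\dots,N-1\}$. Then the ergodic capacity $$C_N=E\left[\frac1N\sum_{n=0}^{N-1}\log_2\bigl(1+\alpha|\hat H_n|^2\bigr)\right]$$ is given by $$C_N=\frac{1}{N\ln 2}\sum_{n=0}^{N-1}\exp\left(\frac{1}{2\alpha\hat\sigma_n^2}\right)\mathrm{Ei}_1\left(\frac{1}{2\alpha\hat\sigma_n^2}\right),$$ where $$\hat\sigma_n^2=\sum_{i=0}^{L-1}\sum_{k=0}^{L-1}\gamma_{ik}\cos\bigl(2\pi(i-k)n/N\bigr),\qquad n\in\{0,\dots,N-1\}.$$ If $\Gamma=\mathrm{diag}(\sigma_0^2,\dots,\sigma_{L-1}^2)$, i.e. the channel taps are uncorrelated (uncorrelated scattering), one obtains $$C_N=\frac{1}{\ln 2}\exp\left(\frac1\alpha\right)\mathrm{Ei}_1\left(\frac1\alpha\right)=:C_{\mathrm{us}},$$ independent of $L$, $N$, and the mean power delay profile $(\sigma_0^2,\dots,\sigma_{L-1}^2)$. This expression is identical to the (known) capacity of the flat Rayleigh fading case ($L=1$).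
   Context: Discrete-time Rayleigh fading channel: $H=X+jY$ with $j$ the imaginary unit, where $X=(X_0,\dots,X_{L-1})$ and $Y=(Y_0,\dots,Y_{L-1})$ are independent and identically distributed real Gaussian random vectors with zero mean and covariance matrix $\Gamma=(\gamma_{ik})$, $\gamma_{ik}=\varrho_{ik}\sigma_i\sigma_k$. Here $\sigma_l^2=E[X_l^2]=E[Y_l^2]=E[|H_l|^2]/2$, and $\varrho_{ik}$ is the normalized correlation between the channel taps $H_i$ and $H_k$. The channel is normalized to have mean power $1$, i.e. $\sum_{l=0}^{L-1}\sigma_l^2=\tfrac12$. The constant $\alpha=P/N_0$ is the average signal-to-noise ratio, where $P$ is the average power constraint on each discrete-time channel input symbol and the additive white Gaussian noise has independent identically distributed real and imaginary parts each of variance $N_0/2$. Capacity is in bits/s/Hz. $\mathrm{Ei}_1(z)=\int_1^\infty e^{-tz}t^{-1}\,dt$. *)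

theory Defs
  imports "HOL-Probability.Probability"
begin

text \<open>
  The normal law with mean \<open>m\<close> and standard deviation \<open>s\<close>. The degenerate case
  \<open>s = 0\<close> (a point mass) has to be allowed, because covariance matrices may be singular.
\<close>

definition normal_law :: "real \<Rightarrow> real \<Rightarrow> real measure" where
  "normal_law m s = (if s = 0 then return borel m else density lborel (normal_density m s))"

text \<open>
  Random vectors of length \<open>L\<close> are families \<open>X 0, \<dots>, X (L - 1)\<close> of random variables.
  Such a vector is Gaussian iff all linear combinations of its entries are normally distributed.
\<close>

definition gaussian_vector :: "'a measure \<Rightarrow> nat \<Rightarrow> (nat \<Rightarrow> 'a \<Rightarrow> real) \<Rightarrow> bool" where
  "gaussian_vector M L X \<longleftrightarrow>
     (\<forall>l<L. X l \<in> borel_measurable M) \<and>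
     (\<forall>a :: nat \<Rightarrow> real. \<exists>m s. s \<ge> 0 \<and>
        distr M borel (\<lambda>\<omega>. \<Sum>l<L. a l * X l \<omega>) = normal_law m s)"

definition covariance :: "'a measure \<Rightarrow> ('a \<Rightarrow> real) \<Rightarrow> ('a \<Rightarrow> real) \<Rightarrow> real" where
  "covariance M U V =
     (\<integral>\<omega>. (U \<omega> - (\<integral>\<omega>'. U \<omega>' \<partial>M)) * (V \<omega> - (\<integral>\<omega>'. V \<omega>' \<partial>M)) \<partial>M)"

definition centered_gaussian_vector ::
  "'a measure \<Rightarrow> nat \<Rightarrow> (nat \<Rightarrow> nat \<Rightarrow> real) \<Rightarrow> (nat \<Rightarrow> 'a \<Rightarrow> real) \<Rightarrow> bool" where
  "centered_gaussian_vector M L \<Gamma> X \<longleftrightarrow>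
     gaussian_vector M L X \<and>
     (\<forall>l<L. (\<integral>\<omega>. X l \<omega> \<partial>M) = 0) \<and>
     (\<forall>i<L. \<forall>k<L. covariance M (X i) (X k) = \<Gamma> i k)"

definition vector_rv :: "nat \<Rightarrow> (nat \<Rightarrow> 'a \<Rightarrow> real) \<Rightarrow> 'a \<Rightarrow> nat \<Rightarrow> real" where
  "vector_rv L X \<omega> = (\<lambda>l\<in>{..<L}. X l \<omega>)"

definition tap :: "(nat \<Rightarrow> 'a \<Rightarrow> real) \<Rightarrow> (nat \<Rightarrow> 'a \<Rightarrow> real) \<Rightarrow> nat \<Rightarrow> 'a \<Rightarrow> complex" where
  "tap X Y l \<omega> = complex_of_real (X l \<omega>) + \<i> * complex_of_real (Y l \<omega>)"

definition normalized_correlation ::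
  "'a measure \<Rightarrow> ('a \<Rightarrow> complex) \<Rightarrow> ('a \<Rightarrow> complex) \<Rightarrow> complex" where
  "normalized_correlation M U V =
     (\<integral>\<omega>. U \<omega> * cnj (V \<omega>) \<partial>M) /
     complex_of_real (sqrt ((\<integral>\<omega>. (cmod (U \<omega>))\<^sup>2 \<partial>M) * (\<integral>\<omega>. (cmod (V \<omega>))\<^sup>2 \<partial>M)))"

text \<open>
  The discrete-time Rayleigh fading channel with \<open>L\<close> taps \<open>H\<^sub>l = X\<^sub>l + \<i> Y\<^sub>l\<close>. The normalized
  correlation of two taps is only constrained when both taps have positive power; otherwise it
  is undefined and its value is irrelevant to \<open>\<Gamma>\<close>.
\<close>

locale rayleigh_channel = prob_space M
  for M :: "'a measure" +
  fixes L :: nat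
    and \<sigma> :: "nat \<Rightarrow> real"
    and \<rho> :: "nat \<Rightarrow> nat \<Rightarrow> real"
    and \<Gamma> :: "nat \<Rightarrow> nat \<Rightarrow> real"
    and X Y :: "nat \<Rightarrow> 'a \<Rightarrow> real"
  assumes gaussian_X: "centered_gaussian_vector M L \<Gamma> X"
    and gaussian_Y: "centered_gaussian_vector M L \<Gamma> Y"
    and indep_XY: "indep_var (Pi\<^sub>M {..<L} (\<lambda>_. borel)) (vector_rv L X)
                             (Pi\<^sub>M {..<L} (\<lambda>_. borel)) (vector_rv L Y)"
    and ident_distr_XY: "distr M (Pi\<^sub>M {..<L} (\<lambda>_. borel)) (vector_rv L X) =
                         distr M (Pi\<^sub>M {..<L} (\<lambda>_. borel)) (vector_rv L Y)"
    and sigma_nonneg: "\<And>l. l < L \<Longrightarrow> \<sigma> l \<ge> 0"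
    and sigma_square: "\<And>l. l < L \<Longrightarrow> (\<sigma> l)\<^sup>2 = expectation (\<lambda>\<omega>. (X l \<omega>)\<^sup>2)"
    and rho_correlation: "\<And>i k. i < L \<Longrightarrow> k < L \<Longrightarrow> \<sigma> i > 0 \<Longrightarrow> \<sigma> k > 0 \<Longrightarrow>
          complex_of_real (\<rho> i k) = normalized_correlation M (tap X Y i) (tap X Y k)"
    and Gamma_eq: "\<And>i k. i < L \<Longrightarrow> k < L \<Longrightarrow> \<Gamma> i k = \<rho> i k * \<sigma> i * \<sigma> k"
    and unit_power: "(\<Sum>l<L. (\<sigma> l)\<^sup>2) = 1 / 2"

definition freq_response ::
  "nat \<Rightarrow> nat \<Rightarrow> (nat \<Rightarrow> 'a \<Rightarrow> complex) \<Rightarrow> nat \<Rightarrow> 'a \<Rightarrow> complex" where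
  "freq_response L N H n \<omega> =
     (\<Sum>l<L. H l \<omega> * exp (- (\<i> * complex_of_real (2 * pi * real n * real l / real N))))"

definition ergodic_capacity ::
  "'a measure \<Rightarrow> nat \<Rightarrow> nat \<Rightarrow> real \<Rightarrow> (nat \<Rightarrow> 'a \<Rightarrow> complex) \<Rightarrow> real" where
  "ergodic_capacity M L N \<alpha> H =
     (\<integral>\<omega>. 1 / real N *
        (\<Sum>n<N. log 2 (1 + \<alpha> * (cmod (freq_response L N H n \<omega>))\<^sup>2)) \<partial>M)"

definition flat_capacity :: "'a measure \<Rightarrow> real \<Rightarrow> ('a \<Rightarrow> complex) \<Rightarrow> real" where
  "flat_capacity M \<alpha> H\<^sub>0 = (\<integral>\<omega>. log 2 (1 + \<alpha> * (cmod (H\<^sub>0 \<omega>))\<^sup>2) \<partial>M)"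

definition freq_variance :: "nat \<Rightarrow> nat \<Rightarrow> (nat \<Rightarrow> nat \<Rightarrow> real) \<Rightarrow> nat \<Rightarrow> real" where
  "freq_variance L N \<Gamma> n =
     (\<Sum>i<L. \<Sum>k<L. \<Gamma> i k * cos (2 * pi * (real i - real k) * real n / real N))"

definition Ei1 :: "real \<Rightarrow> real" where
  "Ei1 z = (LINT t:{1..}|lborel. exp (- t * z) / t)"

text \<open>
  If \<open>\<Gamma>\<close> is singular, \<open>freq_variance L N \<Gamma> n\<close> may vanish for some \<open>n\<close>. The term
  \<open>exp z * Ei1 z\<close> with \<open>z = 1 / (2 * \<alpha> * freq_variance L N \<Gamma> n)\<close> is then to be read as its
  limit for \<open>z \<rightarrow> \<infinity>\<close>, which is \<open>0\<close> since \<open>0 \<le> exp z * Ei1 z \<le> 1 / z\<close> for \<open>z > 0\<close>. In HOL,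
  \<open>1 / 0 = 0\<close> and the divergent integral \<open>Ei1 0\<close> equals \<open>0\<close>, so that the formula yields exactly
  this value without a case distinction.
\<close>

lemma Ei1_0: "Ei1 0 = 0"
proof -
  have "\<not> set_integrable lborel {1..} (\<lambda>t::real. 1 / t)"
  proof
    assume int: "set_integrable lborel {1..} (\<lambda>t::real. 1 / t)"
    define c where "c = (LINT t:{1..}|lborel. 1 / t :: real)"
    have bound: "ln b \<le> c" if "b \<ge> 1" for b :: real
    proof -
      have FTC: "has_bochner_integral lborel (\<lambda>x. indicator {1..b} x *\<^sub>R (1 / x)) (ln b - ln 1)"
        using that
        by (intro has_bochner_integral_FTC_Icc)
           (auto intro!: derivative_eq_intros continuous_intros
                 simp: has_real_derivative_iff_has_vector_derivative [symmetric])
      have "ln b = (LINT t:{1..b}|lborel. 1 / t)"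
        using FTC by (simp add: set_lebesgue_integral_def has_bochner_integral_integral_eq)
      also have "\<dots> \<le> c"
        unfolding c_def set_lebesgue_integral_def
        using int FTC
        by (intro integral_mono)
           (auto simp: set_integrable_def has_bochner_integral_iff indicator_def)
      finally show ?thesis .
    qed
    have "ln (exp (\<bar>c\<bar> + 1)) \<le> c"
      by (rule bound) simp
    then show False by simp
  qed
  then show ?thesis
    by (simp add: Ei1_def set_lebesgue_integral_def set_integrable_def not_integrable_integral_eq)
qed

definition C_us :: "real \<Rightarrow> real" where
  "C_us \<alpha> = 1 / ln 2 * exp (1 / \<alpha>) * Ei1 (1 / \<alpha>)"

end

theory Submission imports Defs "HOL-Real_Asymp.Real_Asymp" begin

text \<open>
  No joint density of real and imaginary part of the frequency response \<open>G\<close> is needed; the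
  covariance matrix may be singular. For real \<open>x, y\<close> the variable \<open>x Re G + y Im G\<close> is a sum of
  two independent centered normal variables with total variance \<open>v (x\<^sup>2 + y\<^sup>2)\<close>, where \<open>v\<close> is the
  frequency variance. Averaging its characteristic function over independent normal \<open>x, y\<close> gives
  the Laplace transform \<open>E exp (- t \<bar>G\<bar>\<^sup>2) = 1 / (1 + 2 v t)\<close>. Inserting this into Frullani's
  integral \<open>ln (1 + r) = \<integral> (1 - exp (- t r)) exp (- t) / t dt\<close> over \<open>t > 0\<close> yields
  \<open>E ln (1 + \<alpha> \<bar>G\<bar>\<^sup>2) = \<integral> exp (- t) c / (1 + c t) dt\<close> with \<open>c = 2 \<alpha> v\<close>, which is
  \<open>exp (1 / c) Ei1 (1 / c)\<close> by an affine substitution.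
\<close>

section \<open>Half-line integrals for the logarithm and \<open>Ei1\<close>\<close>

lemma nn_integral_exp_atLeast_0:
  fixes a :: real
  assumes "a > 0"
  shows "(\<integral>\<^sup>+t. ennreal (exp (- (t * a))) * indicator {0..} t \<partial>lborel) = ennreal (1 / a)"
proof -
  have "(\<integral>\<^sup>+t. ennreal (exp (- (t * a))) * indicator {0..} t \<partial>lborel) =
      ennreal (0 - (- exp (- (0 * a)) / a))"
  proof (rule nn_integral_FTC_atLeast)
    have "filterlim (\<lambda>t. - (t * a)) at_bot at_top"
      using assms by real_asymp
    then have "((\<lambda>t. exp (- (t * a))) \<longlongrightarrow> 0) at_top"
      by (rule filterlim_compose[OF exp_at_bot])
    then have "((\<lambda>t. - exp (- (t * a)) / a) \<longlongrightarrow> - 0 / a) at_top"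
      using assms by (intro tendsto_intros) auto
    then show "((\<lambda>t. - exp (- (t * a)) / a) \<longlongrightarrow> 0) at_top" by simp
  qed (use assms in \<open>auto intro!: derivative_eq_intros\<close>)
  then show ?thesis by simp
qed

text \<open>The factor \<open>(1 - exp (- (t * x))) / t\<close> comes from integrating
  \<open>exp (- (t * s))\<close> over \<open>s\<close> in \<open>{0..x}\<close>. Exchanging the two
  nonnegative integrals leaves the integral of \<open>1 / (1 + s)\<close> over
  \<open>{0..x}\<close>.\<close>

lemma frullani_ln:
  fixes x :: real
  assumes "x \<ge> 0"
  shows "(\<integral>\<^sup>+t. ennreal ((1 - exp (- (t * x))) * exp (- t) / t) * indicator {0..} t \<partial>lborel) = ennreal (ln (1 + x))"
proof -
  have inner: "(\<integral>\<^sup>+s. ennreal (exp (- (t * (1 + s)))) * indicator {0..x} s \<partial>lborel) =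
      ennreal ((1 - exp (- (t * x))) * exp (- t) / t)" if "t > 0" for t :: real
  proof -
    have "(\<integral>\<^sup>+s. ennreal (exp (- (t * (1 + s)))) * indicator {0..x} s \<partial>lborel) =
        ennreal ((- exp (- (t * (1 + x))) / t) - (- exp (- (t * (1 + 0))) / t))"
      using that assms
      by (intro nn_integral_FTC_Icc) (auto intro!: derivative_eq_intros)
    also have "(- exp (- (t * (1 + x))) / t) - (- exp (- (t * (1 + 0))) / t) =
        (1 - exp (- (t * x))) * exp (- t) / t"
      using that by (simp add: field_simps exp_add [symmetric] exp_diff [symmetric] exp_minus)
    finally show ?thesis .
  qed
  have "(\<integral>\<^sup>+t. ennreal ((1 - exp (- (t * x))) * exp (- t) / t) * indicator {0..} t \<partial>lborel) =
      (\<integral>\<^sup>+t. (\<integral>\<^sup>+s. ennreal (exp (- (t * (1 + s)))) * indicator {0..} t * indicator {0..x} s \<partial>lborel) \<partial>lborel)"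
    \<comment> \<open>At \<open>t = 0\<close> the quotient is 0 by the convention for division,
      whereas the inner integral is \<open>x\<close>; this single point is discarded as a null
      set.\<close>
    using AE_lborel_singleton[of 0]
    by (intro nn_integral_cong_AE, eventually_elim)
       (auto simp: inner less_le split: split_indicator)
  also have "\<dots> = (\<integral>\<^sup>+s. (\<integral>\<^sup>+t. ennreal (exp (- (t * (1 + s)))) * indicator {0..} t * indicator {0..x} s \<partial>lborel) \<partial>lborel)"
    by (rule lborel_pair.Fubini') measurable
  also have "\<dots> = (\<integral>\<^sup>+s. ennreal (1 / (1 + s)) * indicator {0..x} s \<partial>lborel)"
    by (intro nn_integral_cong) (auto simp: nn_integral_exp_atLeast_0 nn_integral_multc split: split_indicator)
  also have "\<dots> = ennreal (ln (1 + x) - ln (1 + 0))"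
    using assms by (intro nn_integral_FTC_Icc) (auto intro!: derivative_eq_intros)
  finally show ?thesis by simp
qed

text \<open>The substitution \<open>u = 1 + c * t\<close> maps the half line from 0 onto the half
  line from 1 and turns \<open>exp (- u / c) / u\<close> into the integrand here, up to the factor
  \<open>exp (- (1 / c))\<close>. For \<open>c = 0\<close> both sides vanish, the right one because
  \<open>1 / 0 = 0\<close> and \<open>Ei1 0 = 0\<close>.\<close>

lemma nn_integral_exp_rational_eq_Ei1:
  fixes c :: real
  assumes "c \<ge> 0"
  shows "(\<integral>\<^sup>+t. ennreal (exp (- t) * c / (1 + c * t)) * indicator {0..} t \<partial>lborel) =
    ennreal (exp (1 / c) * Ei1 (1 / c))"
proof (cases "c = 0")
  case True
  then show ?thesis by (simp add: Ei1_0)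
next
  case False
  with assms have c: "c > 0" by simp
  let ?g = "\<lambda>t. indicator {0..} t * (exp (- t) * c / (1 + c * t)) :: real"
  \<comment> \<open>\<open>Ei1\<close> is a Bochner integral, so comparing it with a nonnegative
    integral needs integrability; \<open>c * exp (- t)\<close> serves as the dominating
    function.\<close>
  have "integrable lborel (\<lambda>t. indicator {0..} t *\<^sub>R exp (- t) :: real)"
    using nn_integral_exp_atLeast_0[of 1]
    by (intro integrableI_nonneg) (auto simp: ennreal_mult' ennreal_indicator mult.commute)
  then have "integrable lborel (\<lambda>t. c * (indicator {0..} t *\<^sub>R exp (- t)) :: real)"
    by (rule integrable_mult_right)
  then have int: "integrable lborel ?g"
  proof (rule Bochner_Integration.integrable_bound)
    have "exp (- t) * c / (1 + c * t) \<le> c * exp (- t)" if "t \<ge> 0" for t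
      using c that by (simp add: divide_le_eq add_pos_nonneg algebra_simps)
    then show "AE t in lborel. norm (?g t) \<le> norm (c * (indicator {0..} t *\<^sub>R exp (- t)))"
      using c by (intro AE_I2) (auto simp: indicator_def)
  qed simp
  have "Ei1 (1 / c) = \<bar>c\<bar> *\<^sub>R (\<integral>t. indicator {1..} (1 + c * t) *\<^sub>R (exp (- (1 + c * t) * (1 / c)) / (1 + c * t)) \<partial>lborel)"
    using c unfolding Ei1_def set_lebesgue_integral_def by (intro lborel_integral_real_affine) simp
  also have "\<dots> = exp (- (1 / c)) * (\<integral>t. ?g t \<partial>lborel)"
  proof -
    have *: "indicator {1..} (1 + c * t) *\<^sub>R (exp (- (1 + c * t) * (1 / c)) / (1 + c * t)) = exp (- (1 / c)) / c * ?g t" for t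
    proof -
      have "- (1 + c * t) * (1 / c) = - (1 / c) + - t" using c by (simp add: field_simps)
      then have "exp (- (1 + c * t) * (1 / c)) = exp (- (1 / c)) * exp (- t)"
        by (simp only: exp_add)
      then show ?thesis using c by (simp only:) (simp add: zero_le_mult_iff indicator_def)
    qed
    show ?thesis unfolding * integral_mult_right_zero using c by simp
  qed
  finally have Ei: "exp (1 / c) * Ei1 (1 / c) = (\<integral>t. ?g t \<partial>lborel)"
    by (simp add: exp_minus field_simps)
  have "(\<integral>\<^sup>+t. ennreal (exp (- t) * c / (1 + c * t)) * indicator {0..} t \<partial>lborel) = (\<integral>\<^sup>+t. ennreal (?g t) \<partial>lborel)"
    by (intro nn_integral_cong) (auto simp: indicator_def)
  also have "\<dots> = ennreal (\<integral>t. ?g t \<partial>lborel)"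
    using c by (intro nn_integral_eq_integral[OF int] AE_I2) (auto simp: indicator_def)
  finally show ?thesis by (simp add: Ei)
qed

text \<open>Applying \<open>frullani_ln\<close> at \<open>R \<omega>\<close> and exchanging
  integrals leaves the Laplace transform of \<open>R\<close>, and
  \<open>(1 - 1 / (1 + c * t)) / t = c / (1 + c * t)\<close>. For \<open>c > 0\<close> the assumed
  transform is that of the exponential law with mean \<open>c\<close>; for \<open>c = 0\<close> it
  is that of the point mass at 0.\<close>

lemma (in prob_space) has_bochner_integral_ln_one_plus_of_laplace:
  fixes R :: "'a \<Rightarrow> real" and c :: real
  assumes [measurable]: "random_variable borel R"
    and nonneg: "\<And>\<omega>. 0 \<le> R \<omega>" and "c \<ge> 0"
    and laplace: "\<And>t. t > 0 \<Longrightarrow> expectation (\<lambda>\<omega>. exp (- (t * R \<omega>))) = 1 / (1 + c * t)"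
  shows "has_bochner_integral M (\<lambda>\<omega>. ln (1 + R \<omega>)) (exp (1 / c) * Ei1 (1 / c))"
proof (rule has_bochner_integral_nn_integral)
  show "0 \<le> exp (1 / c) * Ei1 (1 / c)"
    by (auto simp: Ei1_def set_lebesgue_integral_def indicator_def
             intro!: mult_nonneg_nonneg Bochner_Integration.integral_nonneg)
  have inner: "(\<integral>\<^sup>+\<omega>. ennreal ((1 - exp (- (t * R \<omega>))) * exp (- t) / t) \<partial>M) = ennreal (exp (- t) * c / (1 + c * t))"
    if "t > 0" for t
  proof -
    have int: "integrable M (\<lambda>\<omega>. exp (- (t * R \<omega>)))"
      using that nonneg by (intro integrable_const_bound[where B=1] AE_I2) auto
    have pos: "1 + c * t > 0" using \<open>c \<ge> 0\<close> that by (simp add: add_pos_nonneg)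
    have "(\<integral>\<^sup>+\<omega>. ennreal ((1 - exp (- (t * R \<omega>))) * exp (- t) / t) \<partial>M) =
        ennreal (\<integral>\<omega>. (1 - exp (- (t * R \<omega>))) * exp (- t) / t \<partial>M)"
      using int that nonneg by (intro nn_integral_eq_integral) auto
    also have "(\<integral>\<omega>. (1 - exp (- (t * R \<omega>))) * exp (- t) / t \<partial>M) = (1 - 1 / (1 + c * t)) * exp (- t) / t"
      using int by (simp add: prob_space laplace[OF that])
    also have "1 - 1 / (1 + c * t) = c * t / (1 + c * t)"
      using pos by (simp add: field_simps)
    also have "c * t / (1 + c * t) * exp (- t) / t = exp (- t) * c / (1 + c * t)"
      using that by simp
    finally show ?thesis .
  qed
  interpret pair_sigma_finite M lborel ..
  have "(\<integral>\<^sup>+\<omega>. ennreal (ln (1 + R \<omega>)) \<partial>M) =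
      (\<integral>\<^sup>+\<omega>. (\<integral>\<^sup>+t. ennreal ((1 - exp (- (t * R \<omega>))) * exp (- t) / t) * indicator {0..} t \<partial>lborel) \<partial>M)"
    by (simp add: frullani_ln nonneg)
  also have "\<dots> = (\<integral>\<^sup>+t. (\<integral>\<^sup>+\<omega>. ennreal ((1 - exp (- (t * R \<omega>))) * exp (- t) / t) * indicator {0..} t \<partial>M) \<partial>lborel)"
    by (rule Fubini'[symmetric]) measurable
  also have "\<dots> = (\<integral>\<^sup>+t. ennreal (exp (- t) * c / (1 + c * t)) * indicator {0..} t \<partial>lborel)"
    using AE_lborel_singleton[of 0]
    by (intro nn_integral_cong_AE, eventually_elim)
       (auto simp: inner indicator_def)
  also have "\<dots> = ennreal (exp (1 / c) * Ei1 (1 / c))"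
    by (rule nn_integral_exp_rational_eq_Ei1) fact
  finally show "(\<integral>\<^sup>+\<omega>. ennreal (ln (1 + R \<omega>)) \<partial>M) = ennreal (exp (1 / c) * Ei1 (1 / c))" .
qed (use nonneg in auto)

section \<open>Normal laws and Gaussian vectors: moments and characteristic functions\<close>

text \<open>The affine image form covers the point mass \<open>s = 0\<close> and the density case at
  once, so that moments and characteristic functions can be transported from the standard normal law
  without further case distinctions.\<close>

lemma normal_law_eq_distr_std_normal:
  assumes "s \<ge> 0"
  shows "normal_law m s = distr std_normal_distribution borel (\<lambda>x. m + s * x)"
proof -
  interpret S: real_distribution std_normal_distribution by (rule real_dist_normal_dist)
  show ?thesis
  proof (cases "s = 0")
    case True
    then show ?thesis by (simp add: normal_law_def S.distr_const)
  next
    case False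
    with assms have s: "s > 0" by simp
    have "distributed std_normal_distribution lborel (\<lambda>x. x) std_normal_density"
      by (auto simp: distributed_def distr_id2)
    from S.normal_density_affine[OF this _ False, of m] s
    have "distributed std_normal_distribution lborel (\<lambda>x. m + s * x) (normal_density m s)"
      by simp
    then show ?thesis using s
      by (auto simp: normal_law_def distributed_def cong: distr_cong)
  qed
qed

lemma std_normal_moments:
  "has_bochner_integral std_normal_distribution (\<lambda>x. x) 0"
  "has_bochner_integral std_normal_distribution (\<lambda>x. x\<^sup>2) 1"
  using integrable_std_normal_distribution_moment[of 1] integrable_std_normal_distribution_moment[of 2]
    integral_std_normal_distribution_moment_odd[of 1] std_normal_distribution_even_moments[of 1]
  by (auto simp: has_bochner_integral_iff)

lemma char_normal_law:
  assumes "s \<ge> 0"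
  shows "char (normal_law m s) t = iexp (t * m) * of_real (exp (- (s * t)\<^sup>2 / 2))"
proof -
  have "char (normal_law m s) t = (CLINT x|std_normal_distribution. iexp (t * m) * iexp ((s * t) * x))"
    unfolding char_def normal_law_eq_distr_std_normal[OF assms]
    by (subst integral_distr) (auto simp: algebra_simps exp_add)
  also have "\<dots> = iexp (t * m) * char std_normal_distribution (s * t)"
    unfolding char_def by (rule integral_mult_right_zero)
  finally show ?thesis by (simp add: char_std_normal_distribution)
qed

text \<open>\<open>gaussian_vector\<close> only asserts that some parameters \<open>m\<close> and
  \<open>s\<close> exist; these moments identify them and supply integrability.\<close>

lemma (in prob_space) normal_law_moments:
  assumes [measurable]: "random_variable borel W" and "s \<ge> 0" and W: "distr M borel W = normal_law m s"
  shows "has_bochner_integral M W m" "has_bochner_integral M (\<lambda>\<omega>. (W \<omega>)\<^sup>2) (m\<^sup>2 + s\<^sup>2)"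
proof -
  interpret S: real_distribution std_normal_distribution by (rule real_dist_normal_dist)
  \<comment> \<open>Change of variables twice, from \<open>M\<close> to the law of \<open>W\<close>
    and from there to the standard normal law. The equivalence carries integrability together with
    the value.\<close>
  have tr: "has_bochner_integral M (\<lambda>\<omega>. f (W \<omega>)) y \<longleftrightarrow>
      has_bochner_integral std_normal_distribution (\<lambda>x. f (m + s * x)) y"
    if [measurable]: "f \<in> borel_measurable borel" for f :: "real \<Rightarrow> real" and y
  proof -
    have "has_bochner_integral M (\<lambda>\<omega>. f (W \<omega>)) y \<longleftrightarrow> has_bochner_integral (distr M borel W) f y"
      by (simp add: has_bochner_integral_iff integrable_distr_eq integral_distr)
    also have "\<dots> \<longleftrightarrow> has_bochner_integral std_normal_distribution (\<lambda>x. f (m + s * x)) y"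
      by (simp add: W normal_law_eq_distr_std_normal \<open>s \<ge> 0\<close> has_bochner_integral_iff integrable_distr_eq integral_distr)
    finally show ?thesis .
  qed
  note mom = std_normal_moments[unfolded has_bochner_integral_iff]
  show "has_bochner_integral M W m"
    using mom S.prob_space by (subst tr[of "\<lambda>x. x"]) (simp_all add: has_bochner_integral_iff)
  show "has_bochner_integral M (\<lambda>\<omega>. (W \<omega>)\<^sup>2) (m\<^sup>2 + s\<^sup>2)"
    using mom S.prob_space
    by (subst tr[of "\<lambda>x. x\<^sup>2"]) (simp_all add: has_bochner_integral_iff power2_sum power_mult_distrib)
qed

lemma centered_gaussian_vector_normal_law:
  fixes a :: "nat \<Rightarrow> real"
  assumes "centered_gaussian_vector M L \<Gamma> X"
  obtains m s where "s \<ge> 0" "distr M borel (\<lambda>\<omega>. \<Sum>l<L. a l * X l \<omega>) = normal_law m s"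
proof -
  have "\<exists>m s. s \<ge> 0 \<and> distr M borel (\<lambda>\<omega>. \<Sum>l<L. a l * X l \<omega>) = normal_law m s"
    using assms unfolding centered_gaussian_vector_def gaussian_vector_def
    by (elim conjE) (erule spec)
  then show thesis by (elim exE conjE) (rule that)
qed

text \<open>A Bochner integral defaults to 0 on non-integrable functions, so
  \<open>covariance\<close> alone does not give integrability. It follows from normality: each
  coordinate is the linear combination with unit vector coefficients, hence square integrable, and a
  product is dominated by the sum of the two squares.\<close>

lemma (in prob_space) centered_gaussian_vector_second_moment:
  assumes X: "centered_gaussian_vector M L \<Gamma> X" and "i < L" "k < L"
  shows "integrable M (\<lambda>\<omega>. X i \<omega> * X k \<omega>)" "expectation (\<lambda>\<omega>. X i \<omega> * X k \<omega>) = \<Gamma> i k"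
proof -
  have sq: "integrable M (\<lambda>\<omega>. (X l \<omega>)\<^sup>2)" if "l < L" for l
  proof -
    have "random_variable borel (X l)"
      using X that by (simp add: centered_gaussian_vector_def gaussian_vector_def)
    moreover obtain m s where "s \<ge> 0" "distr M borel (\<lambda>\<omega>. \<Sum>j<L. (if j = l then 1 else 0) * X j \<omega>) = normal_law m s"
      by (rule centered_gaussian_vector_normal_law[OF X])
    moreover have "(\<Sum>j<L. (if j = l then 1 else 0) * X j \<omega>) = X l \<omega>" for \<omega>
      using that by (simp add: if_distrib[of "\<lambda>x. x * _"] sum.delta cong: if_cong)
    ultimately show ?thesis
      using normal_law_moments(2)[of "X l" s m] by (simp add: has_bochner_integral_iff)
  qed
  have [measurable]: "random_variable borel (X i)" "random_variable borel (X k)"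
    using X assms(2,3) by (auto simp: centered_gaussian_vector_def gaussian_vector_def)
  show "integrable M (\<lambda>\<omega>. X i \<omega> * X k \<omega>)"
  proof (rule Bochner_Integration.integrable_bound)
    show "integrable M (\<lambda>\<omega>. (X i \<omega>)\<^sup>2 + (X k \<omega>)\<^sup>2)" using sq assms(2,3) by simp
    show "AE \<omega> in M. norm (X i \<omega> * X k \<omega>) \<le> norm ((X i \<omega>)\<^sup>2 + (X k \<omega>)\<^sup>2)"
    proof (rule AE_I2)
      fix \<omega>
      show "norm (X i \<omega> * X k \<omega>) \<le> norm ((X i \<omega>)\<^sup>2 + (X k \<omega>)\<^sup>2)"
        using sum_squares_bound[of "\<bar>X i \<omega>\<bar>" "\<bar>X k \<omega>\<bar>"]
          mult_nonneg_nonneg[OF abs_ge_zero abs_ge_zero, of "X i \<omega>" "X k \<omega>"]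
        unfolding real_norm_def abs_mult power2_abs by linarith
    qed
  qed simp
  have "expectation (X i) = 0" "expectation (X k) = 0" "covariance M (X i) (X k) = \<Gamma> i k"
    using X assms(2,3) by (auto simp: centered_gaussian_vector_def)
  then show "expectation (\<lambda>\<omega>. X i \<omega> * X k \<omega>) = \<Gamma> i k"
    by (simp add: covariance_def)
qed

text \<open>The combination has law \<open>normal_law m s\<close> for some \<open>m\<close> and
  \<open>s\<close>. Linearity of expectation forces \<open>m = 0\<close>, and expanding the second
  moment gives \<open>s\<^sup>2 = q\<close>; this also shows that \<Gamma> is positive
  semidefinite.\<close>

lemma (in prob_space) centered_gaussian_vector_linear_combination:
  fixes a :: "nat \<Rightarrow> real"
  assumes X: "centered_gaussian_vector M L \<Gamma> X"
  defines "q \<equiv> \<Sum>i<L. \<Sum>k<L. a i * a k * \<Gamma> i k"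
  shows "0 \<le> q"
    and "char (distr M borel (\<lambda>\<omega>. \<Sum>l<L. a l * X l \<omega>)) t = of_real (exp (- q * t\<^sup>2 / 2))"
proof -
  let ?W = "\<lambda>\<omega>. \<Sum>l<L. a l * X l \<omega>"
  have [measurable]: "\<And>l. l < L \<Longrightarrow> random_variable borel (X l)"
    using X by (auto simp: centered_gaussian_vector_def gaussian_vector_def)
  have W [measurable]: "random_variable borel ?W"
    by (intro borel_measurable_sum) auto
  obtain m s where s: "s \<ge> 0" "distr M borel ?W = normal_law m s"
    by (rule centered_gaussian_vector_normal_law[OF X])
  note mom = normal_law_moments[OF W s, unfolded has_bochner_integral_iff]
  have intX: "integrable M (X l)" if "l < L" for l
    using centered_gaussian_vector_second_moment(1)[OF X that that] that
    by (intro square_integrable_imp_integrable[of "X l"]) (auto simp: power2_eq_square)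
  have "m = (\<Sum>l<L. a l * expectation (X l))"
    using mom(1) intX by (auto simp: integral_sum)
  also have "\<dots> = 0" using X by (simp add: centered_gaussian_vector_def)
  finally have m: "m = 0" .
  have "m\<^sup>2 + s\<^sup>2 = expectation (\<lambda>\<omega>. \<Sum>i<L. \<Sum>k<L. a i * a k * (X i \<omega> * X k \<omega>))"
    using mom(2) by (simp add: power2_eq_square sum_product mult_ac)
  also have "\<dots> = (\<Sum>i<L. \<Sum>k<L. expectation (\<lambda>\<omega>. a i * a k * (X i \<omega> * X k \<omega>)))"
  proof -
    have int: "integrable M (\<lambda>\<omega>. a i * a k * (X i \<omega> * X k \<omega>))" if "i \<in> {..<L}" "k \<in> {..<L}" for i k
      using centered_gaussian_vector_second_moment(1)[OF X] that by simp
    show ?thesis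
      by (subst Bochner_Integration.integral_sum)
         (intro sum.cong refl Bochner_Integration.integral_sum Bochner_Integration.integrable_sum int; assumption)+
  qed
  also have "\<dots> = q"
    using centered_gaussian_vector_second_moment(2)[OF X] unfolding q_def by simp
  finally have q: "q = s\<^sup>2" using m by simp
  show "0 \<le> q" using q by simp
  show "char (distr M borel ?W) t = of_real (exp (- q * t\<^sup>2 / 2))"
    using char_normal_law[OF s(1)] by (simp add: s(2) m q power_mult_distrib)
qed

section \<open>Laplace transform of a squared modulus\<close>

text \<open>For each outcome, \<open>exp (- (t * (A\<^sup>2 + B\<^sup>2)))\<close> is a Gaussian
  average of \<open>iexp (r * x * A + r * y * B)\<close> over independent standard normal
  \<open>x\<close> and \<open>y\<close>. After exchanging the averages, \<open>char_AB\<close>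
  evaluates the inner one to a product of a function of \<open>x\<close> and the same function of
  \<open>y\<close>; each factor integrates to \<open>1 / sqrt (1 + 2 * v * t)\<close>.\<close>

lemma (in prob_space) laplace_norm_square_of_isotropic_char:
  fixes A B :: "'a \<Rightarrow> real" and v t :: real
  assumes [measurable]: "random_variable borel A" "random_variable borel B"
    and "v \<ge> 0" "t \<ge> 0"
    and char_AB: "\<And>x y. expectation (\<lambda>\<omega>. iexp (x * A \<omega> + y * B \<omega>)) = of_real (exp (- v * (x\<^sup>2 + y\<^sup>2) / 2))"
  shows "expectation (\<lambda>\<omega>. exp (- (t * ((A \<omega>)\<^sup>2 + (B \<omega>)\<^sup>2)))) = 1 / (1 + 2 * v * t)"
proof -
  let ?S = std_normal_distribution
  interpret S: real_distribution ?S by (rule real_dist_normal_dist)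
  interpret SS: pair_prob_space ?S ?S ..
  interpret P: pair_prob_space M "?S \<Otimes>\<^sub>M ?S" ..
  \<comment> \<open>Chosen so that the standard normal characteristic function at
    \<open>r * a\<close>, which is \<open>exp (- (r * a)\<^sup>2 / 2)\<close>, equals
    \<open>exp (- (t * a\<^sup>2))\<close>.\<close>
  define r where "r = sqrt (2 * t)"
  have r: "r\<^sup>2 = 2 * t" using \<open>t \<ge> 0\<close> by (simp add: r_def)
  have gauss: "(CLINT x|?S. iexp (r * x * a)) = of_real (exp (- (t * a\<^sup>2)))" for a
    using char_std_normal_distribution[THEN fun_cong, of "r * a"]
    by (simp add: char_def mult_ac power_mult_distrib r)
  \<comment> \<open>Needed twice: to assemble the Gaussian average in two variables, and to split
    the result after the exchange of integrals.\<close>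
  have prod_int: "(CLINT p|(?S \<Otimes>\<^sub>M ?S). f (fst p) * g (snd p)) = (CLINT x|?S. f x) * (CLINT y|?S. g y)"
    if [measurable]: "f \<in> borel_measurable borel" "g \<in> borel_measurable borel"
      and bd: "\<And>x. norm (f x) \<le> 1" "\<And>x. norm (g x) \<le> 1" for f g :: "real \<Rightarrow> complex"
  proof -
    have "integrable (?S \<Otimes>\<^sub>M ?S) (\<lambda>p. f (fst p) * g (snd p))"
      using bd by (intro SS.integrable_const_bound[where B=1] AE_I2) (auto simp: norm_mult intro!: mult_le_one)
    from SS.integral_fst'[OF this] show ?thesis by simp
  qed
  have gauss2: "(CLINT p|(?S \<Otimes>\<^sub>M ?S). iexp (r * fst p * a) * iexp (r * snd p * b)) =
      of_real (exp (- (t * a\<^sup>2))) * of_real (exp (- (t * b\<^sup>2)))" for a b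
  proof -
    have "(CLINT p|(?S \<Otimes>\<^sub>M ?S). iexp (r * fst p * a) * iexp (r * snd p * b)) =
        (CLINT x|?S. iexp (r * x * a)) * (CLINT y|?S. iexp (r * y * b))"
      by (rule prod_int) (auto simp: norm_exp_eq_Re)
    then show ?thesis by (simp only: gauss)
  qed
  have "complex_of_real (expectation (\<lambda>\<omega>. exp (- (t * ((A \<omega>)\<^sup>2 + (B \<omega>)\<^sup>2))))) =
      (CLINT \<omega>|M. of_real (exp (- (t * (A \<omega>)\<^sup>2))) * of_real (exp (- (t * (B \<omega>)\<^sup>2))))"
    by (simp flip: integral_complex_of_real of_real_mult exp_add add: algebra_simps)
  also have "\<dots> = (CLINT \<omega>|M. CLINT p|(?S \<Otimes>\<^sub>M ?S). iexp (r * fst p * A \<omega>) * iexp (r * snd p * B \<omega>))"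
    by (simp only: gauss2)
  also have "\<dots> = (CLINT \<omega>|M. CLINT p|(?S \<Otimes>\<^sub>M ?S). iexp ((r * fst p) * A \<omega> + (r * snd p) * B \<omega>))"
    by (simp add: exp_add algebra_simps)
  \<comment> \<open>The integrand has modulus 1 on a probability space, so Fubini's theorem
    applies.\<close>
  also have "\<dots> = (CLINT p|(?S \<Otimes>\<^sub>M ?S). CLINT \<omega>|M. iexp ((r * fst p) * A \<omega> + (r * snd p) * B \<omega>))"
    by (rule P.Fubini_integral[symmetric])
       (auto intro!: P.integrable_const_bound[where B=1] AE_I2 simp: norm_exp_eq_Re)
  also have "\<dots> = (CLINT p|(?S \<Otimes>\<^sub>M ?S). of_real (exp (- (v * t) * (fst p)\<^sup>2)) * of_real (exp (- (v * t) * (snd p)\<^sup>2)))"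
  proof -
    have "- v * ((r * x)\<^sup>2 + (r * y)\<^sup>2) / 2 = - (v * t) * x\<^sup>2 + - (v * t) * y\<^sup>2" for x y
      by (simp add: power_mult_distrib r field_simps)
    then show ?thesis by (simp only: char_AB exp_add of_real_mult)
  qed
  also have "\<dots> = (CLINT x|?S. of_real (exp (- (v * t) * x\<^sup>2))) * (CLINT x|?S. of_real (exp (- (v * t) * x\<^sup>2)))"
    using \<open>v \<ge> 0\<close> \<open>t \<ge> 0\<close> by (intro prod_int) auto
  also have "(CLINT x|?S. of_real (exp (- (v * t) * x\<^sup>2))) = complex_of_real (1 / sqrt (1 + 2 * v * t))"
  proof -
    \<comment> \<open>With this standard deviation the exponents combine, \<open>x\<^sup>2 / 2 + v *
      t * x\<^sup>2 = x\<^sup>2 / (2 * \<tau>\<^sup>2)\<close>. The integrand becomes \<tau> times a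
      normal density, which has total mass 1.\<close>
    define \<tau> where "\<tau> = 1 / sqrt (1 + 2 * v * t)"
    have pos: "1 + 2 * v * t > 0" using \<open>v \<ge> 0\<close> \<open>t \<ge> 0\<close> by (simp add: add_pos_nonneg)
    have \<tau>: "\<tau> > 0" using pos by (simp add: \<tau>_def)
    have \<tau>2: "1 / \<tau>\<^sup>2 = 1 + 2 * v * t" using pos by (simp add: \<tau>_def power_divide)
    have "std_normal_density x * exp (- (v * t) * x\<^sup>2) = \<tau> * normal_density 0 \<tau> x" for x
    proof -
      have "x\<^sup>2 / (2 * \<tau>\<^sup>2) = x\<^sup>2 / 2 * (1 / \<tau>\<^sup>2)" by simp
      also have "\<dots> = x\<^sup>2 / 2 + v * t * x\<^sup>2" unfolding \<tau>2 by (simp add: algebra_simps)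
      finally have "- x\<^sup>2 / (2 * \<tau>\<^sup>2) = - x\<^sup>2 / 2 + - (v * t) * x\<^sup>2" by simp
      then have "exp (- x\<^sup>2 / (2 * \<tau>\<^sup>2)) = exp (- x\<^sup>2 / 2) * exp (- (v * t) * x\<^sup>2)"
        by (simp only: exp_add)
      then show ?thesis using \<tau>
        by (simp add: normal_density_def real_sqrt_mult)
    qed
    then have "(\<integral>x. exp (- (v * t) * x\<^sup>2) \<partial>?S) = \<tau>"
      using \<tau> by (subst integral_real_density) auto
    then show ?thesis by (simp add: \<tau>_def)
  qed
  finally have "complex_of_real (expectation (\<lambda>\<omega>. exp (- (t * ((A \<omega>)\<^sup>2 + (B \<omega>)\<^sup>2))))) =
      complex_of_real (1 / sqrt (1 + 2 * v * t) * (1 / sqrt (1 + 2 * v * t)))"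
    by (simp only: of_real_mult)
  then have "expectation (\<lambda>\<omega>. exp (- (t * ((A \<omega>)\<^sup>2 + (B \<omega>)\<^sup>2)))) = 1 / sqrt (1 + 2 * v * t) * (1 / sqrt (1 + 2 * v * t))"
    by (simp only: of_real_eq_iff)
  then show ?thesis using \<open>v \<ge> 0\<close> \<open>t \<ge> 0\<close> by (simp add: real_sqrt_mult_self)
qed

section \<open>The frequency response of the Rayleigh channel\<close>

lemma Re_freq_response_tap:
  "Re (freq_response L N (tap X Y) n \<omega>) =
    (\<Sum>l<L. cos (2 * pi * n * l / N) * X l \<omega> + sin (2 * pi * n * l / N) * Y l \<omega>)"
  and Im_freq_response_tap:
  "Im (freq_response L N (tap X Y) n \<omega>) =
    (\<Sum>l<L. cos (2 * pi * n * l / N) * Y l \<omega> - sin (2 * pi * n * l / N) * X l \<omega>)"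
  by (auto simp: freq_response_def tap_def Re_exp Im_exp mult_ac intro!: sum.cong)

context rayleigh_channel
begin

lemma measurable_taps [measurable]:
  assumes "l < L"
  shows "random_variable borel (X l)" "random_variable borel (Y l)"
  using gaussian_X gaussian_Y assms by (auto simp: centered_gaussian_vector_def gaussian_vector_def)

lemma measurable_freq_response [measurable]:
  "freq_response L N (tap X Y) n \<in> borel_measurable M"
  unfolding freq_response_def tap_def by (intro borel_measurable_sum) auto

text \<open>Independence of the vectors passes to the two linear forms, so the characteristic
  function of their sum at 1 is a product. Both factors are Gaussian with the same \<Gamma>, and the
  quadratic forms add.\<close>

lemma char_linear_combination:
  fixes a b :: "nat \<Rightarrow> real"
  shows "expectation (\<lambda>\<omega>. iexp ((\<Sum>l<L. a l * X l \<omega>) + (\<Sum>l<L. b l * Y l \<omega>))) =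
    of_real (exp (- (\<Sum>i<L. \<Sum>k<L. (a i * a k + b i * b k) * \<Gamma> i k) / 2))"
proof -
  let ?U = "\<lambda>\<omega>. \<Sum>l<L. a l * X l \<omega>" and ?V = "\<lambda>\<omega>. \<Sum>l<L. b l * Y l \<omega>"
  have "indep_var borel ((\<lambda>v. \<Sum>l<L. a l * v l) \<circ> vector_rv L X) borel ((\<lambda>v. \<Sum>l<L. b l * v l) \<circ> vector_rv L Y)"
    by (rule indep_var_compose[OF indep_XY]) measurable
  then have indep: "indep_var borel ?U borel ?V"
    by (simp add: comp_def vector_rv_def)
  have [measurable]: "random_variable borel ?U" "random_variable borel ?V"
    using indep by (blast dest: indep_var_rv1 indep_var_rv2)+
  have "expectation (\<lambda>\<omega>. iexp (?U \<omega> + ?V \<omega>)) = char (distr M borel (\<lambda>\<omega>. ?U \<omega> + ?V \<omega>)) 1"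
    unfolding char_def by (subst integral_distr) simp_all
  also have "\<dots> = char (distr M borel ?U) 1 * char (distr M borel ?V) 1"
    by (rule char_distr_add[OF indep])
  also have "\<dots> = of_real (exp (- (\<Sum>i<L. \<Sum>k<L. a i * a k * \<Gamma> i k) / 2)) * of_real (exp (- (\<Sum>i<L. \<Sum>k<L. b i * b k * \<Gamma> i k) / 2))"
    by (simp only: centered_gaussian_vector_linear_combination(2)[OF gaussian_X]
          centered_gaussian_vector_linear_combination(2)[OF gaussian_Y]) simp
  also have "\<dots> = of_real (exp (- (\<Sum>i<L. \<Sum>k<L. a i * a k * \<Gamma> i k) / 2 + - (\<Sum>i<L. \<Sum>k<L. b i * b k * \<Gamma> i k) / 2))"
    by (simp only: exp_add of_real_mult)
  also have "- (\<Sum>i<L. \<Sum>k<L. a i * a k * \<Gamma> i k) / 2 + - (\<Sum>i<L. \<Sum>k<L. b i * b k * \<Gamma> i k) / 2 =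
      - (\<Sum>i<L. \<Sum>k<L. (a i * a k + b i * b k) * \<Gamma> i k) / 2"
    by (simp add: sum.distrib distrib_right)
  finally show ?thesis .
qed

text \<open>The pair \<open>(x * c i - y * s i, x * s i + y * c i)\<close> is \<open>(x, y)\<close>
  rotated by the angle \<open>2 * pi * n * i / N\<close>. The inner product of two rotations of the
  same vector is its squared length times the cosine of the angle difference.\<close>

lemma freq_variance_quadratic_form:
  fixes x y :: real and N n :: nat
  defines "c \<equiv> \<lambda>l. cos (2 * pi * real n * real l / real N)"
    and "s \<equiv> \<lambda>l. sin (2 * pi * real n * real l / real N)"
  shows "(\<Sum>i<L. \<Sum>k<L. ((x * c i - y * s i) * (x * c k - y * s k) + (x * s i + y * c i) * (x * s k + y * c k)) * \<Gamma> i k) =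
    freq_variance L N \<Gamma> n * (x\<^sup>2 + y\<^sup>2)"
proof -
  have "cos (2 * pi * (real i - real k) * real n / real N) = c i * c k + s i * s k" for i k
    unfolding c_def s_def cos_diff [symmetric] by (simp add: algebra_simps diff_divide_distrib)
  then have "((x * c i - y * s i) * (x * c k - y * s k) + (x * s i + y * c i) * (x * s k + y * c k)) * \<Gamma> i k =
      \<Gamma> i k * cos (2 * pi * (real i - real k) * real n / real N) * (x\<^sup>2 + y\<^sup>2)" for i k
    by (simp add: algebra_simps power2_eq_square)
  then show ?thesis
    by (simp only: freq_variance_def sum_distrib_right)
qed

text \<open>At \<open>x = 1\<close> and \<open>y = 0\<close> the quadratic form splits into the
  values of \<Gamma> on the cosine and the sine vector, both nonnegative because \<Gamma> is a
  covariance matrix.\<close>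

lemma freq_variance_nonneg: "freq_variance L N \<Gamma> n \<ge> 0"
proof -
  let ?c = "\<lambda>l. cos (2 * pi * real n * real l / real N)" and ?s = "\<lambda>l. sin (2 * pi * real n * real l / real N)"
  have "freq_variance L N \<Gamma> n = (\<Sum>i<L. \<Sum>k<L. ?c i * ?c k * \<Gamma> i k) + (\<Sum>i<L. \<Sum>k<L. ?s i * ?s k * \<Gamma> i k)"
    using freq_variance_quadratic_form[where x=1 and y=0 and N=N and n=n] by (simp add: distrib_right sum.distrib)
  then show ?thesis
    using centered_gaussian_vector_linear_combination(1)[OF gaussian_X] by simp
qed

text \<open>Sorting by \<open>X l\<close> and \<open>Y l\<close> yields exactly the rotated
  coefficients of \<open>freq_variance_quadratic_form\<close>, hence dependence on \<open>x\<close>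
  and \<open>y\<close> through \<open>x\<^sup>2 + y\<^sup>2\<close> only.\<close>

lemma char_freq_response:
  "expectation (\<lambda>\<omega>. iexp (x * Re (freq_response L N (tap X Y) n \<omega>) + y * Im (freq_response L N (tap X Y) n \<omega>))) =
    of_real (exp (- freq_variance L N \<Gamma> n * (x\<^sup>2 + y\<^sup>2) / 2))"
proof -
  let ?c = "\<lambda>l. cos (2 * pi * real n * real l / real N)" and ?s = "\<lambda>l. sin (2 * pi * real n * real l / real N)"
  have "x * Re (freq_response L N (tap X Y) n \<omega>) + y * Im (freq_response L N (tap X Y) n \<omega>) =
      (\<Sum>l<L. (x * ?c l - y * ?s l) * X l \<omega>) + (\<Sum>l<L. (x * ?s l + y * ?c l) * Y l \<omega>)" for \<omega>
    unfolding Re_freq_response_tap Im_freq_response_tap sum_distrib_left sum.distrib [symmetric]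
    by (intro sum.cong) (auto simp: algebra_simps)
  then show ?thesis
    by (simp only: char_linear_combination freq_variance_quadratic_form mult_minus_left)
qed

text \<open>The Laplace transform of \<alpha> times the squared modulus at \<open>t\<close> is that
  of the squared modulus at \<open>t * \<alpha>\<close>, which has the required shape with
  \<open>c = 2 * \<alpha> * freq_variance L N \<Gamma> n\<close>.\<close>

lemma has_bochner_integral_ln_freq_response:
  assumes "\<alpha> > 0"
  shows "has_bochner_integral M (\<lambda>\<omega>. ln (1 + \<alpha> * (cmod (freq_response L N (tap X Y) n \<omega>))\<^sup>2))
    (exp (1 / (2 * \<alpha> * freq_variance L N \<Gamma> n)) * Ei1 (1 / (2 * \<alpha> * freq_variance L N \<Gamma> n)))"
proof (rule has_bochner_integral_ln_one_plus_of_laplace)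
  fix t :: real
  assume "t > 0"
  then have "expectation (\<lambda>\<omega>. exp (- (t * \<alpha> * ((Re (freq_response L N (tap X Y) n \<omega>))\<^sup>2 + (Im (freq_response L N (tap X Y) n \<omega>))\<^sup>2)))) =
      1 / (1 + 2 * freq_variance L N \<Gamma> n * (t * \<alpha>))"
    using \<open>\<alpha> > 0\<close> freq_variance_nonneg char_freq_response
    by (intro laplace_norm_square_of_isotropic_char) auto
  then show "expectation (\<lambda>\<omega>. exp (- (t * (\<alpha> * (cmod (freq_response L N (tap X Y) n \<omega>))\<^sup>2)))) =
      1 / (1 + 2 * \<alpha> * freq_variance L N \<Gamma> n * t)"
    by (simp add: cmod_power2 mult_ac)
qed (use assms freq_variance_nonneg in auto)

lemma ergodic_capacity_eq:
  assumes "\<alpha> > 0"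
  shows "ergodic_capacity M L N \<alpha> (tap X Y) =
    1 / (real N * ln 2) *
    (\<Sum>n<N. exp (1 / (2 * \<alpha> * freq_variance L N \<Gamma> n)) * Ei1 (1 / (2 * \<alpha> * freq_variance L N \<Gamma> n)))"
  \<comment> \<open>Integrability of every summand lets the expectation pass through the finite
    sum.\<close>
  using has_bochner_integral_ln_freq_response[OF assms, unfolded has_bochner_integral_iff]
  by (simp add: ergodic_capacity_def log_def integral_sum flip: sum_divide_distrib)

lemma Gamma_diagonal:
  assumes "l < L"
  shows "\<Gamma> l l = (\<sigma> l)\<^sup>2"
  using centered_gaussian_vector_second_moment(2)[OF gaussian_X assms assms] sigma_square[OF assms]
  by (simp add: power2_eq_square)

text \<open>Only the terms \<open>i = k\<close> survive, where the cosine is 1, so every frequency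
  variance equals the total power \<open>1 / 2\<close>. All \<open>N\<close> summands then agree and
  cancel the factor \<open>1 / N\<close>.\<close>

lemma ergodic_capacity_uncorrelated:
  assumes "\<alpha> > 0" and "N \<ge> 1"
    and diag: "\<And>i k. i < L \<Longrightarrow> k < L \<Longrightarrow> i \<noteq> k \<Longrightarrow> \<Gamma> i k = 0"
  shows "ergodic_capacity M L N \<alpha> (tap X Y) = C_us \<alpha>"
proof -
  have half: "freq_variance L N \<Gamma> n = 1 / 2" for n
  proof -
    have "freq_variance L N \<Gamma> n = (\<Sum>i<L. \<Sum>k<L. if i = k then (\<sigma> i)\<^sup>2 else 0)"
      unfolding freq_variance_def by (intro sum.cong refl) (auto simp: diag Gamma_diagonal)
    also have "\<dots> = 1 / 2" using unit_power by simp
    finally show ?thesis .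
  qed
  show ?thesis
    using \<open>N \<ge> 1\<close> by (simp add: ergodic_capacity_eq[OF \<open>\<alpha> > 0\<close>] half C_us_def)
qed

end

section \<open>Flat fading and the capacity formulas\<close>

lemma flat_capacity_eq_ergodic_capacity:
  "flat_capacity M \<alpha> (tap X Y 0) = ergodic_capacity M 1 1 \<alpha> (tap X Y)"
  by (simp add: flat_capacity_def ergodic_capacity_def freq_response_def)

theorem theorem2:
  fixes M :: "'a measure" and L N :: nat and \<alpha> :: real
    and \<sigma> :: "nat \<Rightarrow> real" and \<rho> \<Gamma> :: "nat \<Rightarrow> nat \<Rightarrow> real"
    and X Y :: "nat \<Rightarrow> 'a \<Rightarrow> real"
  assumes "L \<ge> 1" and "N \<ge> 1" and "\<alpha> > 0"
    and "rayleigh_channel M L \<sigma> \<rho> \<Gamma> X Y"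
  shows "ergodic_capacity M L N \<alpha> (tap X Y) =
           1 / (real N * ln 2) *
           (\<Sum>n<N. exp (1 / (2 * \<alpha> * freq_variance L N \<Gamma> n)) *
                    Ei1 (1 / (2 * \<alpha> * freq_variance L N \<Gamma> n)))
       \<and> ((\<forall>i<L. \<forall>k<L. \<Gamma> i k = (if i = k then (\<sigma> i)\<^sup>2 else 0)) \<longrightarrow>
           ergodic_capacity M L N \<alpha> (tap X Y) = C_us \<alpha>)
       \<and> (\<forall>(M' :: 'b measure) \<sigma>' \<rho>' \<Gamma>' X' Y'.
           rayleigh_channel M' 1 \<sigma>' \<rho>' \<Gamma>' X' Y' \<longrightarrow>
           flat_capacity M' \<alpha> (tap X' Y' 0) = C_us \<alpha>)"
proof (intro conjI impI allI)
  interpret rayleigh_channel M L \<sigma> \<rho> \<Gamma> X Y by fact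
  show "ergodic_capacity M L N \<alpha> (tap X Y) =
           1 / (real N * ln 2) *
           (\<Sum>n<N. exp (1 / (2 * \<alpha> * freq_variance L N \<Gamma> n)) *
                    Ei1 (1 / (2 * \<alpha> * freq_variance L N \<Gamma> n)))"
    by (rule ergodic_capacity_eq) fact
  assume "\<forall>i<L. \<forall>k<L. \<Gamma> i k = (if i = k then (\<sigma> i)\<^sup>2 else 0)"
  then show "ergodic_capacity M L N \<alpha> (tap X Y) = C_us \<alpha>"
    using assms(2,3) by (intro ergodic_capacity_uncorrelated) auto
next
  fix M' :: "'b measure" and \<sigma>' \<rho>' \<Gamma>' X' Y'
  assume "rayleigh_channel M' 1 \<sigma>' \<rho>' \<Gamma>' X' Y'"
  then interpret flat: rayleigh_channel M' 1 \<sigma>' \<rho>' \<Gamma>' X' Y' .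
  \<comment> \<open>With a single tap there are no off-diagonal entries, so the uncorrelated case
    applies with \<open>L = N = 1\<close>.\<close>
  show "flat_capacity M' \<alpha> (tap X' Y' 0) = C_us \<alpha>"
    unfolding flat_capacity_eq_ergodic_capacity
    using assms(3) by (intro flat.ergodic_capacity_uncorrelated) auto
qed

end
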